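(* Let $r>2$ be an integer with prime factorisation $r=2^j p_1^{\alpha_1}\cdots p_k^{\alpha_k}$, where $j\ge 0$ and $p_1,\dots,p_k$ are distinct odd primes (with $\alpha_i\ge 1$). Then for every $n\in\mathbb N$ $$\varphi_r(n)\ \ge\ \prod_{i=1}^k \left\lceil (p_i-1)^{\,n-p_i}\right\rceil .$$
   Context: $\mathbb N$ denotes the positive integers. For an integer $r>2$, $Z_r=(\mathbb Z/r\mathbb Z)^*$ is the group of units modulo $r$, and $[a]_r\in\{0,\dots,r-1\}$ is the residue of $a$ modulo $r$. For $\overline m=(m_1,\dots,m_n)\in (Z_r)^n$ let $\mathsf N_{(r;\overline m)}$ be the directed graph with vertices $c_{s,t}$ ($1\le s\le n$, $0\le t<r$), where the vertices $c_{s,0}$ are called 0-vertices, and with directed edges $c_{s,t}\to c_{s+1,t}$ (for $1\le s<n$) and $c_{s,t}\to c_{s,[t+m_s]_r}$. Let $\mathsf B_{(r;\overline m)}$ be the $n\times n$ integer matrix whose entry $\langle i,j\rangle$ is the number of directed paths (finite walks) in $\mathsf N_{(r;\overline m)}$ from $c_{i,0}$ to $c_{j,0}$ such that (i) the path visits at least one vertex that is not a 0-vertex, and (ii) whenever the path visits a 0-vertex after its starting position, all subsequent vertices of the path are 0-vertices. For integer $n\times n$ matrices $C,D$ write $C\cong D$ if there exist upper triangular integer matrices $X,Y$ with all diagonal entries equal to $1$ such that $XC=DY$. Write $A\sim B$ if $A-I\cong B-I$; this is an equivalence relation. For $n\in\mathbb N$ let $S_{r,n}=\{\mathsf B_{(r;\overline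 m)}\mid \overline m\in (Z_r)^n\}$ and let $\varphi_r(n)$ be the number of $\sim$-equivalence classes of $S_{r,n}$. *)

theory Defs
  imports
    "HOL-Number_Theory.Number_Theory"
    "Jordan_Normal_Form.Matrix"
    "Graph_Theory.Digraph"
    "Graph_Theory.Arc_Walk"
begin

text \<open>
  The vertex \<open>c\<^bsub>s,t\<^esub>\<close> is the pair \<open>(s, t)\<close> and an arc is the pair of its end points. There are
  no parallel arcs, since \<open>c\<^bsub>s+1,t\<^esub> \<noteq> c\<^bsub>s,[t+m\<^sub>s]\<^esub>\<close>. The tuple \<open>m\<close> is a function on \<open>{1..n}\<close>.
\<close>

definition N_graph :: "nat \<Rightarrow> nat \<Rightarrow> (nat \<Rightarrow> nat) \<Rightarrow> (nat \<times> nat, (nat \<times> nat) \<times> (nat \<times> nat)) pre_digraph"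
  where "N_graph r n m =
    \<lparr> verts = {(s, t). 1 \<le> s \<and> s \<le> n \<and> t < r},
      arcs = {((s, t), (s + 1, t)) | s t. 1 \<le> s \<and> s < n \<and> t < r}
           \<union> {((s, t), (s, (t + m s) mod r)) | s t. 1 \<le> s \<and> s \<le> n \<and> t < r},
      tail = fst,
      head = snd \<rparr>"

definition zero_vertex :: "nat \<times> nat \<Rightarrow> bool"
  where "zero_vertex v \<longleftrightarrow> snd v = 0"

text \<open>
  The condition on the sequence of vertices visited by a path; position \<open>0\<close> is the starting
  position, so the constraint on visited 0-vertices only concerns positions \<open>a > 0\<close>.
\<close>

definition admissible :: "(nat \<times> nat) list \<Rightarrow> bool"
  where "admissible vs \<longleftrightarrow>
    (\<exists>v \<in> set vs. \<not> zero_vertex v) \<and>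
    (\<forall>a b. 0 < a \<longrightarrow> a < b \<longrightarrow> b < length vs \<longrightarrow> zero_vertex (vs ! a) \<longrightarrow> zero_vertex (vs ! b))"

definition adm_paths :: "nat \<Rightarrow> nat \<Rightarrow> (nat \<Rightarrow> nat) \<Rightarrow> nat \<Rightarrow> nat \<Rightarrow> ((nat \<times> nat) \<times> (nat \<times> nat)) list set"
  where "adm_paths r n m i j =
    {p. pre_digraph.awalk (N_graph r n m) (i, 0) p (j, 0) \<and>
        admissible (pre_digraph.awalk_verts (N_graph r n m) (i, 0) p)}"

text \<open>
  Matrix indices start at \<open>0\<close>, whereas the rows of the graph are numbered from \<open>1\<close>. The set of
  paths is finite whenever \<open>r > 2\<close> and all \<open>m s\<close> are coprime to \<open>r\<close>.
\<close>

definition B_mat :: "nat \<Rightarrow> nat \<Rightarrow> (nat \<Rightarrow> nat) \<Rightarrow> int mat"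
  where "B_mat r n m = mat n n (\<lambda>(i, j). int (card (adm_paths r n m (i + 1) (j + 1))))"

definition unitriangular :: "nat \<Rightarrow> int mat \<Rightarrow> bool"
  where "unitriangular n X \<longleftrightarrow>
    X \<in> carrier_mat n n \<and> upper_triangular X \<and> (\<forall>i < n. X $$ (i, i) = 1)"

definition ut_equiv :: "nat \<Rightarrow> int mat \<Rightarrow> int mat \<Rightarrow> bool"
  where "ut_equiv n C D \<longleftrightarrow>
    (\<exists>X Y. unitriangular n X \<and> unitriangular n Y \<and> X * C = D * Y)"

definition sim :: "nat \<Rightarrow> int mat \<Rightarrow> int mat \<Rightarrow> bool"
  where "sim n A B \<longleftrightarrow> ut_equiv n (A - 1\<^sub>m n) (B - 1\<^sub>m n)"

text \<open>
  Units modulo \<open>r\<close> are represented by their residues: \<open>totatives r\<close> is the set of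
  \<open>0 < k \<le> r\<close> coprime to \<open>r\<close>, and \<open>k = r\<close> does not occur for \<open>r > 1\<close>.
\<close>

definition S_set :: "nat \<Rightarrow> nat \<Rightarrow> int mat set"
  where "S_set r n = B_mat r n ` ({1..n} \<rightarrow>\<^sub>E totatives r)"

definition num_classes :: "nat \<Rightarrow> nat \<Rightarrow> nat"
  where "num_classes r n =
    card (S_set r n // {(A, B). A \<in> S_set r n \<and> B \<in> S_set r n \<and> sim n A B})"

end

theory Submission
  imports Defs "HOL-Computational_Algebra.Polynomial"
begin

text \<open>
  Fix an odd prime power \<open>q = p\<^sup>a\<close> exactly dividing \<open>r\<close>. Let \<open>G\<^sub>s(x)\<close> be the number of walks from
  \<open>c\<^bsub>s,x\<^esub>\<close> to \<open>c\<^bsub>j,0\<^esub>\<close> that never leave the 0-vertices once they have met one. Following row \<open>s\<close>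
  up to the point where the walk descends gives \<open>G\<^sub>s(m\<^sub>s u) = (\<Sum>v=u..r. G\<^bsub>s+1\<^esub>(m\<^sub>s v))\<close> for
  \<open>1 \<le> u \<le> r\<close>, where \<open>u = r\<close> stands for the residue 0. Hence, modulo \<open>q\<close> and for \<open>k < p\<close>,
  \<open>G\<^bsub>j-k\<^esub>(x)\<close> is a polynomial in \<open>x\<close> of degree at most \<open>k\<close>, whose coefficient of \<open>x\<^sup>k\<close> is
  \<open>(-1)\<^sup>k / (k! m\<^bsub>j-k\<^esub> \<dots> m\<^bsub>j-1\<^esub>)\<close>. The entry \<open>\<langle>i,j\<rangle>\<close> of \<open>B\<close> is the sum of \<open>G\<^bsub>i+1\<^esub>\<close> over all residues.
  Such a sum vanishes modulo \<open>q\<close> in degree below \<open>p - 1\<close>, so the first \<open>p - 1\<close> superdiagonals vanish,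
  and the next one satisfies \<open>B\<^bsub>i,i+p\<^esub> \<cdot> m\<^bsub>i+1\<^esub> \<dots> m\<^bsub>i+p-1\<^esub> \<equiv> (r choose p)\<close>.

  Unitriangular \<open>X\<close> and \<open>Y\<close> do not change the first superdiagonal that is nonzero modulo \<open>q\<close>, and
  \<open>(r choose p)\<close> is not divisible by \<open>q\<close>. So the class of \<open>B\<close> determines modulo \<open>p\<close> the products
  of \<open>p - 1\<close> consecutive \<open>m\<^sub>s\<close>, and these \<open>n - p\<close> products can be prescribed independently, for all
  primes simultaneously by the Chinese remainder theorem.
\<close>

section \<open>Summation of integer polynomials modulo \<open>q\<close>\<close>

lemma cong_poly_int:
  fixes f :: "int poly"
  assumes "[x = y] (mod q)"
  shows "[poly f x = poly f y] (mod q)"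
  by (induction f) (auto intro!: cong_add cong_mult assms)

text \<open>Induction on the degree: the top term of \<open>h\<close> comes from dividing by
  \<open>Suc k\<close>, which is invertible modulo \<open>q\<close>, and the lower terms come from
  the remainder. The leading coefficient is recorded because the window products are later read off
  from it.\<close>

lemma antidifference_mod:
  fixes f :: "int poly" and q :: int
  assumes "\<And>i. 1 \<le> i \<Longrightarrow> i \<le> Suc k \<Longrightarrow> coprime (int i) q" and "degree f \<le> k"
  shows "\<exists>h. degree h \<le> Suc k \<and> (\<forall>x. [poly h (x + 1) - poly h x = poly f x] (mod q)) \<and>
    [int (Suc k) * coeff h (Suc k) = coeff f k] (mod q)"
  using assms
proof (induction k arbitrary: f)
  case (0 f)
  then have "degree f = 0"
    by simp
  then obtain c where "f = [:c:]"
    by (rule degree_eq_zeroE)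
  then show ?case
    by (intro exI[of _ "[:0, c:]"]) (auto simp: algebra_simps)
next
  case (Suc k f)
  define K where "K = Suc k"
  define c where "c = coeff f K"
  obtain a where a: "[int (Suc K) * a = 1] (mod q)"
    using cong_solve_coprime_int[of "int (Suc K)" q] Suc.prems(1)[of "Suc K"] by (auto simp: K_def)
  define h0 where "h0 = monom (a * c) (Suc K)"
  \<comment> \<open>The coefficient of \<open>f - D\<close> at \<open>K\<close> is \<open>e\<close>,
    which vanishes only modulo \<open>q\<close>. Subtracting \<open>monom e K\<close> makes the
    degree drop over the integers, as the induction hypothesis requires.\<close>
  define e where "e = c - int (Suc K) * a * c"
  define D where "D = smult (a * c) ([:1, 1:] ^ Suc K) - h0"
  define d where "d = f - D - monom e K"
  have coeffD: "coeff D i = (if i \<le> K then a * c * int (Suc K choose i) else 0)" for i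
    by (cases "i \<le> Suc K")
      (auto simp: D_def h0_def le_Suc_eq coeff_linear_poly_power coeff_eq_0 degree_linear_power simp del: power_Suc)
  have poly_D: "poly D x = poly h0 (x + 1) - poly h0 x" for x
    by (simp add: D_def h0_def poly_monom add.commute del: power_Suc)
  have e: "[e = 0] (mod q)"
    using cong_mult[OF a cong_refl[of c]]
    by (simp add: e_def cong_iff_dvd_diff dvd_diff_commute algebra_simps)
  have "coeff d i = 0" if "i \<ge> K" for i
  proof (cases "i = K")
    case True
    have "Suc K choose K = Suc K"
      by (metis binomial_Suc_n)
    with True show ?thesis
      by (simp add: d_def coeffD e_def c_def)
  next
    case False
    with that Suc.prems(2) show ?thesis
      by (simp add: d_def coeffD K_def coeff_eq_0)
  qed
  then have "degree d \<le> k"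
    by (intro degree_le) (simp add: K_def)
  then obtain h1 where h1: "degree h1 \<le> Suc k"
    "\<And>x. [poly h1 (x + 1) - poly h1 x = poly d x] (mod q)"
    using Suc.IH[of d] Suc.prems(1) by force
  show ?case
  proof (intro exI[of _ "h0 + h1"] conjI allI)
    show "degree (h0 + h1) \<le> Suc (Suc k)"
      using h1(1) by (intro degree_add_le) (auto simp: h0_def K_def intro: order_trans[OF degree_monom_le])
    have "coeff h1 (Suc K) = 0"
      using h1(1) by (simp add: coeff_eq_0 K_def)
    then have "int (Suc K) * coeff (h0 + h1) (Suc K) = int (Suc K) * a * c"
      by (simp add: h0_def)
    also have "[\<dots> = 1 * c] (mod q)"
      using a by (intro cong_mult) auto
    finally show "[int (Suc (Suc k)) * coeff (h0 + h1) (Suc (Suc k)) = coeff f (Suc k)] (mod q)"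
      by (simp add: K_def c_def)
    fix x
    have "poly (h0 + h1) (x + 1) - poly (h0 + h1) x = poly D x + (poly h1 (x + 1) - poly h1 x)"
      by (simp add: poly_D)
    also have "[\<dots> = poly D x + poly d x] (mod q)"
      by (intro cong_add cong_refl h1)
    also have "poly D x + poly d x = poly f x - e * x ^ K"
      by (simp add: d_def poly_monom)
    also have "[\<dots> = poly f x - 0 * x ^ K] (mod q)"
      by (intro cong_diff cong_mult cong_refl e)
    finally show "[poly (h0 + h1) (x + 1) - poly (h0 + h1) x = poly f x] (mod q)"
      by simp
  qed
qed

lemma sum_telescope_mod:
  fixes h :: "int \<Rightarrow> int"
  assumes "\<And>x. [h (x + 1) - h x = f x] (mod q)" and "u \<le> v"
  shows "[(\<Sum>x=u..<v. f (int x)) = h (int v) - h (int u)] (mod q)"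
proof -
  have "[(\<Sum>x=u..<v. f (int x)) = (\<Sum>x=u..<v. h (int (Suc x)) - h (int x))] (mod q)"
  proof (rule cong_sum)
    show "[f (int x) = h (int (Suc x)) - h (int x)] (mod q)" for x
      using cong_sym[OF assms(1)[of "int x"]] by (simp add: add.commute)
  qed
  also have "(\<Sum>x=u..<v. h (int (Suc x)) - h (int x)) = h (int v) - h (int u)"
    using assms(2) by (rule sum_Suc_diff')
  finally show ?thesis .
qed

text \<open>One row of the recursion. The summand is a polynomial in \<open>v\<close>, so the tail
  sum telescopes to the difference of \<open>h\<close> at \<open>r + 1\<close> and at
  \<open>u\<close>. Substituting \<open>m' * x\<close> for \<open>u\<close> turns this into a
  polynomial in \<open>x = m * u\<close>. Since \<open>u\<close> is the lower limit, the leading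
  coefficient changes sign.\<close>

lemma tail_sum_poly_mod:
  fixes f :: "int poly" and q :: int
  assumes "\<And>i. 1 \<le> i \<Longrightarrow> i \<le> Suc k \<Longrightarrow> coprime (int i) q" and "degree f \<le> k"
    and "coprime m q"
  shows "\<exists>g. degree g \<le> Suc k \<and>
    (\<forall>u. u \<le> r \<longrightarrow> [(\<Sum>v=u..r. poly f (m * int v)) = poly g (m * int u)] (mod q)) \<and>
    [coeff g (Suc k) * int (Suc k) * m = - coeff f k] (mod q)"
proof -
  obtain m' where m': "[m * m' = 1] (mod q)"
    using cong_solve_coprime_int[OF assms(3)] by blast
  define f' where "f' = pcompose f [:0, m:]"
  have "degree f' \<le> k"
    using degree_pcompose_le[of f "[:0, m:]"] assms(2) by (auto simp: f'_def split: if_splits)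
  then obtain h where h: "degree h \<le> Suc k" "\<And>x. [poly h (x + 1) - poly h x = poly f' x] (mod q)"
    "[int (Suc k) * coeff h (Suc k) = coeff f' k] (mod q)"
    using antidifference_mod[OF assms(1), of k f'] by auto
  define g where "g = [:poly h (int (Suc r)):] - pcompose h [:0, m':]"
  show ?thesis
  proof (intro exI[of _ g] conjI allI impI)
    show "degree g \<le> Suc k"
      unfolding g_def using degree_pcompose_le[of h "[:0, m':]"] h(1)
      by (intro degree_diff_le) (auto split: if_splits)
    fix u assume u: "u \<le> r"
    have "[(\<Sum>v=u..<Suc r. poly f' (int v)) = poly h (int (Suc r)) - poly h (int u)] (mod q)"
      using u by (intro sum_telescope_mod h) auto
    then have "[(\<Sum>v=u..r. poly f (m * int v)) = poly h (int (Suc r)) - poly h (int u)] (mod q)"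
      by (simp add: f'_def poly_pcompose atLeastLessThanSuc_atLeastAtMost mult.commute)
    also have "[poly h (int (Suc r)) - poly h (int u) =
      poly h (int (Suc r)) - poly h (m' * (m * int u))] (mod q)"
    proof (intro cong_diff cong_refl cong_poly_int)
      show "[int u = m' * (m * int u)] (mod q)"
        using cong_mult[OF m' cong_refl[of "int u"]] by (simp add: cong_sym_eq mult_ac)
    qed
    finally show "[(\<Sum>v=u..r. poly f (m * int v)) = poly g (m * int u)] (mod q)"
      by (simp add: g_def poly_pcompose mult.commute)
  next
    have "coeff g (Suc k) * int (Suc k) * m = - (int (Suc k) * coeff h (Suc k)) * (m' ^ Suc k * m)"
      by (simp add: g_def coeff_pcompose_linear del: power_Suc)
    also have "[\<dots> = - coeff f' k * (m' ^ Suc k * m)] (mod q)"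
      by (intro cong_mult cong_refl cong_minus_minus_iff[THEN iffD2] h)
    also have "- coeff f' k * (m' ^ Suc k * m) = - coeff f k * (m * m') ^ Suc k"
      by (simp add: f'_def coeff_pcompose_linear power_mult_distrib mult_ac)
    also have "[\<dots> = - coeff f k * 1 ^ Suc k] (mod q)"
      by (intro cong_mult cong_refl cong_pow m')
    finally show "[coeff g (Suc k) * int (Suc k) * m = - coeff f k] (mod q)"
      by simp
  qed
qed

text \<open>Telescoping leaves the difference of \<open>h\<close> at \<open>r\<close> and at 0, and
  \<open>q\<close> divides \<open>r\<close>.\<close>

lemma sum_poly_full_mod:
  fixes f :: "int poly" and q :: int
  assumes "\<And>i. 1 \<le> i \<Longrightarrow> i \<le> Suc k \<Longrightarrow> coprime (int i) q" and "degree f \<le> k"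
    and "q dvd int r"
  shows "[(\<Sum>x<r. poly f (int x)) = 0] (mod q)"
proof -
  obtain h where h: "\<And>x. [poly h (x + 1) - poly h x = poly f x] (mod q)"
    using antidifference_mod[OF assms(1,2)] by auto
  have "[(\<Sum>x=0..<r. poly f (int x)) = poly h (int r) - poly h (int 0)] (mod q)"
    by (intro sum_telescope_mod h) auto
  also have "[poly h (int r) - poly h (int 0) = poly h (int 0) - poly h (int 0)] (mod q)"
    using assms(3) by (intro cong_diff cong_refl cong_poly_int) (simp add: cong_0_iff)
  finally show ?thesis
    by (simp add: atLeast0LessThan)
qed

text \<open>Here \<open>Suc k\<close> may fail to be invertible, so
  \<open>antidifference_mod\<close> does not cover degree \<open>k\<close>. A falling factorial of
  that degree is summed exactly instead, and subtracting a multiple of it lowers the degree to the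
  previous case.\<close>

lemma sum_poly_critical_mod:
  fixes f :: "int poly" and q :: int
  assumes "\<And>i. 1 \<le> i \<Longrightarrow> i \<le> k \<Longrightarrow> coprime (int i) q" and "degree f \<le> k"
    and "q dvd int r"
  shows "[(\<Sum>x<r. poly f (int x)) = coeff f k * fact k * int (r choose Suc k)] (mod q)"
proof -
  \<comment> \<open>The monic falling factorial \<open>x (x - 1) ... (x - k + 1)\<close>. Its values
    are \<open>fact k\<close> times binomial coefficients, which the hockey-stick identity
    sums.\<close>
  define ff :: "int poly" where "ff = (\<Prod>i<k. [:- int i, 1:])"
  have poly_ff: "poly ff (int x) = fact k * int (x choose k)" for x
  proof -
    have "real_of_int (poly ff (int x)) = (\<Prod>i=0..<k. real x - real i)"
      by (simp add: ff_def poly_prod atLeast0LessThan)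
    also have "\<dots> = real_of_int (fact k * int (x choose k))"
      by (simp flip: gbinomial_mult_fact add: binomial_gbinomial)
    finally show ?thesis
      by (simp only: of_int_eq_iff)
  qed
  have deg: "degree ff = k"
    by (simp add: ff_def degree_prod_eq_sum_degree)
  have "lead_coeff ff = 1"
    by (simp add: ff_def lead_coeff_prod )
  then have lead: "coeff ff k = 1"
    by (simp add: deg)
  define d where "d = f - smult (coeff f k) ff"
  have d: "coeff d i = 0" if "i \<ge> k" for i
    using that assms(2) lead deg by (cases "i = k") (auto simp: d_def coeff_eq_0)
  have d0: "[(\<Sum>x<r. poly d (int x)) = 0] (mod q)"
  proof (cases k)
    case 0
    then have "d = 0"
      using d by (intro poly_eqI) auto
    then show ?thesis by simp
  next
    case (Suc l)
    then have "degree d \<le> l"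
      using d by (intro degree_le) auto
    then show ?thesis
      using assms Suc by (intro sum_poly_full_mod) auto
  qed
  have sum_ff: "(\<Sum>x<r. poly ff (int x)) = fact k * int (r choose Suc k)"
  proof (cases r)
    case (Suc s)
    have "(\<Sum>x<r. poly ff (int x)) = fact k * int (\<Sum>x\<le>s. x choose k)"
      by (simp add: poly_ff sum_distrib_left Suc lessThan_Suc_atMost)
    then show ?thesis
      by (simp add: sum_choose_upper Suc)
  qed simp
  have "(\<Sum>x<r. poly f (int x)) = (\<Sum>x<r. poly d (int x)) + coeff f k * (\<Sum>x<r. poly ff (int x))"
    by (simp add: d_def sum_subtractf sum_distrib_left)
  also have "[\<dots> = 0 + coeff f k * (\<Sum>x<r. poly ff (int x))] (mod q)"
    by (intro cong_add cong_refl d0)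
  finally show ?thesis
    by (simp add: sum_ff mult_ac)
qed

section \<open>Counting admissible paths\<close>

abbreviation zero_absorbing :: "(nat \<times> nat) list \<Rightarrow> bool"
  where "zero_absorbing \<equiv> sorted_wrt (\<lambda>v w. zero_vertex v \<longrightarrow> zero_vertex w)"

text \<open>Position 0 is exempt from the second condition and here cannot witness the first, so
  both become conditions on the remaining vertices.\<close>

lemma admissible_Cons:
  assumes "zero_vertex v"
  shows "admissible (v # vs) \<longleftrightarrow> (\<exists>w\<in>set vs. \<not> zero_vertex w) \<and> zero_absorbing vs"
proof -
  have "(\<forall>a b. 0 < a \<longrightarrow> a < b \<longrightarrow> b < length (v # vs) \<longrightarrow>
      zero_vertex ((v # vs) ! a) \<longrightarrow> zero_vertex ((v # vs) ! b)) \<longleftrightarrow> zero_absorbing vs" (is "?L \<longleftrightarrow> ?R")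
  proof
    assume L: ?L
    show ?R
      unfolding sorted_wrt_iff_nth_less
    proof (intro allI impI)
      fix a b assume "a < b" "b < length vs" "zero_vertex (vs ! a)"
      then show "zero_vertex (vs ! b)"
        using L[rule_format, of "Suc a" "Suc b"] by simp
    qed
  next
    assume R: ?R
    show ?L
    proof (intro allI impI)
      fix a b assume "0 < a" "a < b" "b < length (v # vs)" "zero_vertex ((v # vs) ! a)"
      moreover from this obtain a' b' where "a = Suc a'" "b = Suc b'"
        by (metis Suc_lessE less_imp_Suc_add)
      ultimately show "zero_vertex ((v # vs) ! b)"
        using R by (auto simp: sorted_wrt_iff_nth_less)
    qed
  qed
  with assms show ?thesis
    by (auto simp: admissible_def)
qed

locale lens_graph =
  fixes r n :: nat and m :: "nat \<Rightarrow> nat"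
  assumes r_gt: "r > 1" and units: "\<And>s. 1 \<le> s \<Longrightarrow> s \<le> n \<Longrightarrow> coprime (m s) r"
begin

abbreviation "walk \<equiv> pre_digraph.awalk (N_graph r n m)"
abbreviation "walk_verts \<equiv> pre_digraph.awalk_verts (N_graph r n m)"

lemma verts_iff: "(s, t) \<in> verts (N_graph r n m) \<longleftrightarrow> 1 \<le> s \<and> s \<le> n \<and> t < r"
  by (simp add: N_graph_def)

lemma walk_Nil: "walk v [] w \<longleftrightarrow> v = w \<and> v \<in> verts (N_graph r n m)"
  by (auto simp: pre_digraph.awalk_def pre_digraph.cas.simps)

lemma walk_Cons:
  "walk (s, t) (e # p) w \<longleftrightarrow> 1 \<le> s \<and> s \<le> n \<and> t < r \<and>
    (s < n \<and> e = ((s, t), (s + 1, t)) \<and> walk (s + 1, t) p w \<or>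
     e = ((s, t), (s, (t + m s) mod r)) \<and> walk (s, (t + m s) mod r) p w)"
  using r_gt by (auto simp: pre_digraph.awalk_def pre_digraph.cas.simps N_graph_def)

lemma walk_verts_simps [simp]:
  "walk_verts v [] = [v]" "walk_verts v (e # p) = fst e # walk_verts (snd e) p"
  by (simp_all add: pre_digraph.awalk_verts.simps N_graph_def)

lemma hd_walk_verts: "walk v p w \<Longrightarrow> v \<in> set (walk_verts v p)"
  by (cases v; cases p) (auto simp: walk_Cons)

lemma walk_row_mono: "walk v p w \<Longrightarrow> fst v \<le> fst w"
proof (induction p arbitrary: v)
  case (Cons e p)
  then show ?case by (cases v) (fastforce simp: walk_Cons)
qed (auto simp: walk_Nil)

text \<open>Unlike in \<open>admissible\<close>, the starting vertex is constrained too. This closes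
  the family under removal of the first arc, so that it can be counted recursively.\<close>

definition zwalks :: "nat \<Rightarrow> nat \<times> nat \<Rightarrow> ((nat \<times> nat) \<times> (nat \<times> nat)) list set"
  where "zwalks j v = {p. walk v p (j, 0) \<and> zero_absorbing (walk_verts v p)}"

lemma zwalks_beyond: "j < s \<Longrightarrow> zwalks j (s, t) = {}"
  by (auto simp: zwalks_def dest: walk_row_mono)

lemma zwalks_zero_verts:
  assumes "p \<in> zwalks j (s, 0)" "v \<in> set (walk_verts (s, 0) p)"
  shows "zero_vertex v"
proof (cases p)
  case (Cons e q)
  then have "walk_verts (s, 0) p = (s, 0) # walk_verts (snd e) q"
    using assms(1) by (auto simp: zwalks_def walk_Cons)
  then show ?thesis
    using assms by (auto simp: zwalks_def zero_vertex_def)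
qed (use assms in \<open>simp add: zero_vertex_def\<close>)

lemma unit_mult_mod_neq_0:
  assumes "1 \<le> s" "s \<le> n" "0 < u" "u < r"
  shows "m s * u mod r \<noteq> 0"
proof
  assume "m s * u mod r = 0"
  then have "r dvd u"
    using units[OF assms(1,2)] by (metis coprime_commute coprime_dvd_mult_right_iff mod_0_imp_dvd)
  then show False
    using assms by (auto dest: dvd_imp_le)
qed

text \<open>A nonzero start imposes nothing on later vertices, so the first arc is free. The empty
  walk does not occur because walks end at residue 0.\<close>

lemma zwalks_nonzero:
  assumes "1 \<le> s" "s \<le> n" "t < r" "t \<noteq> 0"
  shows "zwalks j (s, t) =
    Cons ((s, t), (s, (t + m s) mod r)) ` zwalks j (s, (t + m s) mod r) \<union>
    (if s < n then Cons ((s, t), (s + 1, t)) ` zwalks j (s + 1, t) else {})" (is "?L = ?R")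
proof (rule Set.set_eqI)
  fix p show "p \<in> ?L \<longleftrightarrow> p \<in> ?R"
    using assms by (cases p) (auto simp: zwalks_def walk_Nil walk_Cons zero_vertex_def)
qed

text \<open>The row arc from a 0-vertex leads to the nonzero residue \<open>m s mod r\<close>, so
  only the descent is allowed.\<close>

lemma zwalks_zero_Cons:
  assumes "e # q \<in> zwalks j (s, 0)"
  shows "s < n \<and> e = ((s, 0), (s + 1, 0)) \<and> q \<in> zwalks j (s + 1, 0)"
proof -
  have w: "walk (s, 0) (e # q) (j, 0)" and z: "zero_absorbing (walk_verts (snd e) q)"
    using assms by (auto simp: zwalks_def)
  then have s: "1 \<le> s" "s \<le> n" and wq: "walk (snd e) q (j, 0)"
    by (auto simp: walk_Cons)
  have "zero_vertex (snd e)"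
    using zwalks_zero_verts[OF assms] hd_walk_verts[OF wq] by simp
  then have "snd e \<noteq> (s, m s mod r)"
    using unit_mult_mod_neq_0[OF s, of 1] r_gt by (auto simp: zero_vertex_def)
  with w have "s < n \<and> e = ((s, 0), (s + 1, 0))"
    unfolding walk_Cons by (metis add_0 snd_conv)
  with wq z show ?thesis
    by (simp add: zwalks_def)
qed

text \<open>The only such walk is the straight descent through 0-vertices.\<close>

lemma card_zwalks_zero:
  assumes "1 \<le> s" "s \<le> j" "j \<le> n"
  shows "card (zwalks j (s, 0)) = 1"
  using assms(2,1)
proof (induction rule: inc_induct)
  case base
  have "p = []" if "p \<in> zwalks j (j, 0)" for p
    using that zwalks_zero_Cons[of _ _ j j] zwalks_beyond[of j "j + 1"] by (cases p) fastforce+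
  moreover have "[] \<in> zwalks j (j, 0)"
    using assms base r_gt by (simp add: zwalks_def walk_Nil verts_iff)
  ultimately have "zwalks j (j, 0) = {[]}"
    by blast
  then show ?case by simp
next
  case (step s)
  have "zwalks j (s, 0) = Cons ((s, 0), (s + 1, 0)) ` zwalks j (s + 1, 0)"
  proof (intro equalityI subsetI)
    fix p assume p: "p \<in> zwalks j (s, 0)"
    have "p \<noteq> []"
      using p step.hyps by (auto simp: zwalks_def walk_Nil)
    then show "p \<in> Cons ((s, 0), (s + 1, 0)) ` zwalks j (s + 1, 0)"
      using p zwalks_zero_Cons[of "hd p" "tl p" j s] by (metis image_eqI list.collapse)
  next
    fix p assume "p \<in> Cons ((s, 0), (s + 1, 0)) ` zwalks j (s + 1, 0)"
    then obtain q where q: "q \<in> zwalks j (s + 1, 0)" and p: "p = ((s, 0), (s + 1, 0)) # q"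
      by blast
    have "walk (s, 0) p (j, 0)"
      using q p step assms(3) r_gt by (simp add: zwalks_def walk_Cons)
    moreover have "zero_absorbing (walk_verts (s, 0) p)"
      using q zwalks_zero_verts[OF q] by (simp add: p zwalks_def)
    ultimately show "p \<in> zwalks j (s, 0)"
      by (simp add: zwalks_def)
  qed
  then show ?case
    using step by (simp add: card_image)
qed

lemma finite_zwalks_zero:
  assumes "1 \<le> s" "s \<le> j" "j \<le> n"
  shows "finite (zwalks j (s, 0))"
  using card_zwalks_zero[OF assms] by (metis card.infinite zero_neq_one)

text \<open>Writing the residue in row \<open>s\<close> as \<open>m s * u mod r\<close> makes the
  row arc increase \<open>u\<close> by one, so walks along the row move towards
  \<open>u = r\<close>, that is, residue 0.\<close>

lemma zwalks_step:
  assumes "1 \<le> s" "s \<le> n" "0 < u" "u < r"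
  shows "zwalks j (s, m s * u mod r) =
    Cons ((s, m s * u mod r), (s, m s * Suc u mod r)) ` zwalks j (s, m s * Suc u mod r) \<union>
    (if s < n then Cons ((s, m s * u mod r), (s + 1, m s * u mod r)) ` zwalks j (s + 1, m s * u mod r) else {})"
proof -
  have "(m s * u mod r + m s) mod r = m s * Suc u mod r"
    by (metis mod_add_left_eq mult_Suc_right add.commute)
  then show ?thesis
    using zwalks_nonzero[of s "m s * u mod r" j] unit_mult_mod_neq_0[OF assms] assms
    by simp
qed

lemma card_zwalks_last_row:
  assumes "1 \<le> j" "j \<le> n" "0 < u" "u \<le> r"
  shows "finite (zwalks j (j, m j * u mod r)) \<and> card (zwalks j (j, m j * u mod r)) = 1"
  using assms(4,3)
proof (induction rule: inc_induct)
  case base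
  then show ?case
    using card_zwalks_zero[of j j] finite_zwalks_zero[of j j] assms by simp
next
  case (step u)
  let ?A = "zwalks j (j, m j * Suc u mod r)"
  have eq: "zwalks j (j, m j * u mod r) = Cons ((j, m j * u mod r), (j, m j * Suc u mod r)) ` ?A"
    using zwalks_step[of j u j] zwalks_beyond[of j "j + 1"] assms(1,2) step.hyps step.prems by simp
  have "finite ?A \<and> card ?A = 1"
    using step.IH by blast
  then show ?case
    unfolding eq by (simp add: card_image)
qed

text \<open>Unrolling \<open>zwalks_step\<close> up to \<open>u = r\<close> classifies the walks by
  the \<open>v\<close> at which they descend. Finiteness in the next row is assumed because
  \<open>finite_zwalks\<close> derives it by induction over rows from this lemma.\<close>

lemma card_zwalks_row:
  assumes "1 \<le> s" "s < j" "j \<le> n" "0 < u" "u \<le> r"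
    and "\<And>t. t < r \<Longrightarrow> finite (zwalks j (s + 1, t))"
  shows "finite (zwalks j (s, m s * u mod r)) \<and>
    card (zwalks j (s, m s * u mod r)) = (\<Sum>v=u..r. card (zwalks j (s + 1, m s * v mod r)))"
  using assms(5,4)
proof (induction rule: inc_induct)
  \<comment> \<open>At \<open>u = r\<close> the residue is 0: the sum has the single term
    \<open>v = r\<close>, and both sides equal 1.\<close>
  case base
  then show ?case
    using card_zwalks_zero[of s j] card_zwalks_zero[of "s + 1" j] finite_zwalks_zero[of s j] assms
    by simp
next
  case (step u)
  let ?A = "zwalks j (s, m s * Suc u mod r)" and ?B = "zwalks j (s + 1, m s * u mod r)"
  have fin: "finite ?A" "finite ?B"
    using step assms(6)[of "m s * u mod r"] r_gt by auto
  have eq: "zwalks j (s, m s * u mod r) =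
      Cons ((s, m s * u mod r), (s, m s * Suc u mod r)) ` ?A \<union>
      Cons ((s, m s * u mod r), (s + 1, m s * u mod r)) ` ?B"
    using zwalks_step[of s u j] assms step.hyps step.prems by simp
  have "card (zwalks j (s, m s * u mod r)) = card ?A + card ?B"
    unfolding eq using fin by (subst card_Un_disjoint) (auto simp: card_image simp del: mult_Suc_right)
  also have "\<dots> = (\<Sum>v=u..r. card (zwalks j (s + 1, m s * v mod r)))"
  proof -
    have "card ?A = (\<Sum>v=Suc u..r. card (zwalks j (s + 1, m s * v mod r)))"
      using step.IH by blast
    moreover have "(\<Sum>v=u..r. card (zwalks j (s + 1, m s * v mod r))) =
        card ?B + (\<Sum>v=Suc u..r. card (zwalks j (s + 1, m s * v mod r)))"
      by (rule sum.atLeast_Suc_atMost) (use step.hyps in linarith)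
    ultimately show ?thesis by linarith
  qed
  finally have "card (zwalks j (s, m s * u mod r)) = (\<Sum>v=u..r. card (zwalks j (s + 1, m s * v mod r)))" .
  moreover have "finite (zwalks j (s, m s * u mod r))"
    unfolding eq using fin by blast
  ultimately show ?case by blast
qed

lemma bij_betw_unit_mult:
  assumes "1 \<le> s" "s \<le> n"
  shows "bij_betw (\<lambda>u. m s * u mod r) {1..r} {..<r}"
proof -
  have inj: "inj_on (\<lambda>u. m s * u mod r) {1..r}"
  proof (rule inj_onI)
    fix u v assume uv: "u \<in> {1..r}" "v \<in> {1..r}" "m s * u mod r = m s * v mod r"
    then have "[u = v] (mod r)"
      using units[OF assms] by (simp add: cong_def[symmetric] cong_mult_lcancel_nat)
    then have "int r dvd int u - int v"
      by (simp flip: cong_int_iff cong_iff_dvd_diff)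
    then show "u = v"
      using uv(1,2) dvd_imp_le_int[of "int u - int v" "int r"] by force
  qed
  then have "card ((\<lambda>u. m s * u mod r) ` {1..r}) = r"
    by (simp add: card_image)
  then have "(\<lambda>u. m s * u mod r) ` {1..r} = {..<r}"
    using r_gt by (intro card_subset_eq) auto
  with inj show ?thesis
    by (simp add: bij_betw_def)
qed

lemma obtain_unit_multiple:
  assumes "1 \<le> s" "s \<le> n" "x < r"
  obtains u where "0 < u" "u \<le> r" "x = m s * u mod r"
proof -
  have "x \<in> (\<lambda>u. m s * u mod r) ` {1..r}"
    using bij_betw_imp_surj_on[OF bij_betw_unit_mult[OF assms(1,2)]] assms(3) by simp
  then obtain u where "u \<in> {1..r}" "x = m s * u mod r"
    by blast
  then show thesis
    by (intro that[of u]) auto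
qed

lemma finite_zwalks:
  assumes "1 \<le> s" "s \<le> j" "j \<le> n" "x < r"
  shows "finite (zwalks j (s, x))"
  using assms(2,1,4)
proof (induction arbitrary: x rule: inc_induct)
  case base
  then show ?case
    using card_zwalks_last_row[of j] assms obtain_unit_multiple[of j x] by metis
next
  case (step s)
  have "s \<le> n"
    using step.hyps(2) assms(3) by simp
  then obtain u where "0 < u" "u \<le> r" "x = m s * u mod r"
    using obtain_unit_multiple[OF step.prems(1) _ step.prems(2)] by blast
  then show ?case
    using card_zwalks_row[of s j u] step assms(3) by simp
qed

text \<open>An initial descent would reach a 0-vertex and then stay among 0-vertices, violating the
  first condition. The row arc reaches a nonzero vertex, which satisfies that condition at
  once.\<close>

lemma adm_paths_eq:
  assumes "1 \<le> i" "i \<le> n"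
  shows "adm_paths r n m i j = Cons ((i, 0), (i, m i mod r)) ` zwalks j (i, m i mod r)"
proof (rule Set.set_eqI)
  fix p
  have nz: "m i mod r \<noteq> 0"
    using unit_mult_mod_neq_0[of i 1] assms r_gt by simp
  show "p \<in> adm_paths r n m i j \<longleftrightarrow> p \<in> Cons ((i, 0), (i, m i mod r)) ` zwalks j (i, m i mod r)"
  proof (cases p)
    case Nil
    then show ?thesis
      by (auto simp: adm_paths_def admissible_def zero_vertex_def)
  next
    case (Cons e q)
    let ?w = "\<lambda>v. walk v q (j, 0)" and ?z = "\<lambda>v. zero_absorbing (walk_verts v q)"
    let ?nz = "\<lambda>v. \<exists>w\<in>set (walk_verts v q). \<not> zero_vertex w"
    have up: "\<not> (?w (i + 1, 0) \<and> ?nz (i + 1, 0) \<and> ?z (i + 1, 0))"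
      using zwalks_zero_verts[of q j "i + 1"] unfolding zwalks_def by blast
    have along: "?nz (i, m i mod r)" if "?w (i, m i mod r)"
      using hd_walk_verts[OF that] nz unfolding zero_vertex_def by force
    have "walk (i, 0) p (j, 0) \<longleftrightarrow>
      i < n \<and> e = ((i, 0), (i + 1, 0)) \<and> ?w (i + 1, 0) \<or> e = ((i, 0), (i, m i mod r)) \<and> ?w (i, m i mod r)"
      using assms r_gt by (simp add: Cons walk_Cons)
    moreover have "p \<in> adm_paths r n m i j \<longleftrightarrow> walk (i, 0) p (j, 0) \<and> ?nz (snd e) \<and> ?z (snd e)"
      using admissible_Cons[of "(i, 0)" "walk_verts (snd e) q"]
      by (auto simp: adm_paths_def Cons walk_Cons zero_vertex_def[of "(i, 0)"])
    ultimately have "p \<in> adm_paths r n m i j \<longleftrightarrow>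
      e = ((i, 0), (i, m i mod r)) \<and> ?w (i, m i mod r) \<and> ?z (i, m i mod r)"
      using up along by (metis snd_conv)
    then show ?thesis
      by (auto simp: Cons zwalks_def)
  qed
qed

text \<open>The function \<open>G\<close> of the overview with its target row \<open>j\<close> made
  explicit, integer-valued for the congruences below.\<close>

definition level_count :: "nat \<Rightarrow> nat \<Rightarrow> nat \<Rightarrow> int"
  where "level_count j s x = int (card (zwalks j (s, x)))"

lemma level_count_last:
  assumes "1 \<le> j" "j \<le> n" "x < r"
  shows "level_count j j x = 1"
proof -
  obtain u where "0 < u" "u \<le> r" "x = m j * u mod r"
    using obtain_unit_multiple assms by blast
  then show ?thesis
    using card_zwalks_last_row[of j u] assms by (simp add: level_count_def)
qed

lemma level_count_step:
  assumes "1 \<le> s" "s < j" "j \<le> n" "0 < u" "u \<le> r"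
  shows "level_count j s (m s * u mod r) = (\<Sum>v=u..r. level_count j (s + 1) (m s * v mod r))"
proof -
  have "finite (zwalks j (s + 1, t))" if "t < r" for t
    using assms that by (intro finite_zwalks) auto
  then show ?thesis
    using card_zwalks_row[OF assms] by (simp add: level_count_def)
qed

lemma card_adm_paths:
  assumes "1 \<le> i" "i \<le> n"
  shows "int (card (adm_paths r n m i j)) = level_count j i (m i mod r)"
  using assms by (simp add: adm_paths_eq card_image level_count_def)

lemma card_adm_paths_same: "1 \<le> i \<Longrightarrow> i \<le> n \<Longrightarrow> int (card (adm_paths r n m i i)) = 1"
  using r_gt by (simp add: card_adm_paths level_count_last)

lemma card_adm_paths_below: "1 \<le> i \<Longrightarrow> i \<le> n \<Longrightarrow> j < i \<Longrightarrow> int (card (adm_paths r n m i j)) = 0"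
  by (simp add: card_adm_paths level_count_def zwalks_beyond)

text \<open>After the forced first arc \<open>u = 1\<close>, so the tail sum runs over all residues
  and reindexing removes \<open>m i\<close>. This is why the windows start at
  \<open>i + 1\<close>.\<close>

lemma card_adm_paths_above:
  assumes "1 \<le> i" "i < j" "j \<le> n"
  shows "int (card (adm_paths r n m i j)) = (\<Sum>x<r. level_count j (i + 1) x)"
proof -
  have "int (card (adm_paths r n m i j)) = level_count j i (m i * 1 mod r)"
    using assms by (simp add: card_adm_paths)
  also have "\<dots> = (\<Sum>v=1..r. level_count j (i + 1) (m i * v mod r))"
    using assms r_gt by (intro level_count_step) auto
  also have "\<dots> = (\<Sum>x<r. level_count j (i + 1) x)"
    using assms by (intro sum.reindex_bij_betw bij_betw_unit_mult) auto
  finally show ?thesis .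
qed

end

section \<open>Matrix entries modulo \<open>q\<close>\<close>

context lens_graph begin

text \<open>Induction on the distance \<open>k\<close> from the target row, with
  \<open>tail_sum_poly_mod\<close> as the step. The leading coefficient is stated with denominators
  cleared, so no inverses modulo \<open>q\<close> appear.\<close>

lemma level_count_poly:
  fixes q :: int
  assumes "\<And>i. 1 \<le> i \<Longrightarrow> i < p \<Longrightarrow> coprime (int i) q" and "q dvd int r"
    and "k < p" "k < j" "j \<le> n"
  shows "\<exists>F. degree F \<le> k \<and> (\<forall>x<r. [level_count j (j - k) x = poly F (int x)] (mod q)) \<and>
    [coeff F k * fact k * (\<Prod>s=j-k..<j. int (m s)) = (-1) ^ k] (mod q)"
  using assms(3,4)
proof (induction k)
  case 0
  then show ?case
    using assms(5) by (intro exI[of _ "[:1:]"]) (simp add: level_count_last)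
next
  case (Suc k)
  define s where "s = j - Suc k"
  have s: "1 \<le> s" "s < j" "s \<le> n" "j - k = s + 1"
    using Suc.prems assms(5) by (auto simp: s_def)
  obtain F where F: "degree F \<le> k" "\<And>x. x < r \<Longrightarrow> [level_count j (s + 1) x = poly F (int x)] (mod q)"
    "[coeff F k * fact k * (\<Prod>t=s+1..<j. int (m t)) = (-1) ^ k] (mod q)"
    using Suc unfolding s(4) by force
  have "coprime (int (m s)) q"
    using units[OF s(1,3)] coprime_divisors[of "int (m s)" "int (m s)" q "int r"] assms(2) by simp
  then obtain g where g: "degree g \<le> Suc k"
    "\<And>u. u \<le> r \<Longrightarrow> [(\<Sum>v=u..r. poly F (int (m s) * int v)) = poly g (int (m s) * int u)] (mod q)"
    "[coeff g (Suc k) * int (Suc k) * int (m s) = - coeff F k] (mod q)"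
    using tail_sum_poly_mod[of k q F "int (m s)" r] assms(1) F(1) Suc.prems by auto
  \<comment> \<open>Since \<open>q\<close> divides \<open>r\<close>, the reduction modulo
    \<open>r\<close> in the vertex labels is invisible modulo \<open>q\<close>.\<close>
  have mod_r: "[int (a mod r) = int a] (mod q)" for a
    using assms(2) by (rule cong_dvd_modulus[rotated]) (simp add: of_nat_mod)
  have "[level_count j s x = poly g (int x)] (mod q)" if x: "x < r" for x
  proof -
    obtain u where u: "0 < u" "u \<le> r" "x = m s * u mod r"
      using obtain_unit_multiple[OF s(1,3) x] by blast
    have "level_count j s x = (\<Sum>v=u..r. level_count j (s + 1) (m s * v mod r))"
      unfolding u(3) by (intro level_count_step s u assms(5))
    also have "[\<dots> = (\<Sum>v=u..r. poly F (int (m s) * int v))] (mod q)"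
    proof (rule cong_sum)
      fix v
      have "[level_count j (s + 1) (m s * v mod r) = poly F (int (m s * v mod r))] (mod q)"
        using r_gt by (intro F(2)) simp
      also have "[poly F (int (m s * v mod r)) = poly F (int (m s) * int v)] (mod q)"
        using mod_r[of "m s * v"] by (intro cong_poly_int) simp
      finally show "[level_count j (s + 1) (m s * v mod r) = poly F (int (m s) * int v)] (mod q)" .
    qed
    also have "[(\<Sum>v=u..r. poly F (int (m s) * int v)) = poly g (int (m s) * int u)] (mod q)"
      by (intro g u)
    also have "[poly g (int (m s) * int u) = poly g (int x)] (mod q)"
      using mod_r[of "m s * u"] u(3) by (intro cong_poly_int) (simp add: cong_sym_eq)
    finally show ?thesis .
  qed
  moreover have "[coeff g (Suc k) * fact (Suc k) * (\<Prod>t=s..<j. int (m t)) = (-1) ^ Suc k] (mod q)"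
  proof -
    have "coeff g (Suc k) * fact (Suc k) * (\<Prod>t=s..<j. int (m t)) =
      (coeff g (Suc k) * int (Suc k) * int (m s)) * (fact k * (\<Prod>t=s+1..<j. int (m t)))"
      using s(2) by (simp add: prod.atLeast_Suc_lessThan mult_ac)
    also have "[\<dots> = - coeff F k * (fact k * (\<Prod>t=s+1..<j. int (m t)))] (mod q)"
      by (intro cong_mult cong_refl g)
    also have "- coeff F k * (fact k * (\<Prod>t=s+1..<j. int (m t))) =
      - (coeff F k * fact k * (\<Prod>t=s+1..<j. int (m t)))"
      by simp
    also have "[\<dots> = - ((-1) ^ k)] (mod q)"
      using F(3) by (simp only: cong_minus_minus_iff)
    finally show ?thesis by simp
  qed
  ultimately show ?case
    using g(1) unfolding s_def by blast
qed

lemma card_adm_paths_subcritical: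
  fixes q :: int
  assumes "\<And>i. 1 \<le> i \<Longrightarrow> i < p \<Longrightarrow> coprime (int i) q" and "q dvd int r"
    and "1 \<le> i" "i < j" "j \<le> n" "j < i + p"
  shows "[int (card (adm_paths r n m i j)) = 0] (mod q)"
proof -
  \<comment> \<open>The distance from row \<open>i + 1\<close> to row \<open>j\<close>. The bound
    \<open>j < i + p\<close> gives \<open>Suc k < p\<close>, so the full sum vanishes.\<close>
  define k where "k = j - Suc i"
  have k: "k < p" "k < j" "j - k = i + 1" "Suc k < p"
    using assms(3-6) by (auto simp: k_def)
  obtain F where F: "degree F \<le> k" "\<And>x. x < r \<Longrightarrow> [level_count j (i + 1) x = poly F (int x)] (mod q)"
    using level_count_poly[OF assms(1,2) k(1,2) assms(5)] unfolding k(3) by blast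
  have "int (card (adm_paths r n m i j)) = (\<Sum>x<r. level_count j (i + 1) x)"
    by (intro card_adm_paths_above assms)
  also have "[\<dots> = (\<Sum>x<r. poly F (int x))] (mod q)"
    by (intro cong_sum F) simp
  also have "[(\<Sum>x<r. poly F (int x)) = 0] (mod q)"
    using k(4) by (intro sum_poly_full_mod[of k] assms(1,2) F(1)) auto
  finally show ?thesis .
qed

text \<open>The distance from row \<open>i + 1\<close> to the target is now \<open>p - 1\<close>, so
  \<open>sum_poly_critical_mod\<close> applies. Multiplying by the window product eliminates the
  leading coefficient.\<close>

lemma card_adm_paths_critical:
  fixes q :: int
  assumes "\<And>i. 1 \<le> i \<Longrightarrow> i < p \<Longrightarrow> coprime (int i) q" and "q dvd int r"
    and "1 \<le> i" "i + p \<le> n" "0 < p"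
  shows "[int (card (adm_paths r n m i (i + p))) * (\<Prod>s=i+1..<i+p. int (m s)) =
    (-1) ^ (p - 1) * int (r choose p)] (mod q)"
proof -
  define j where "j = i + p"
  define P where "P = (\<Prod>s=i+1..<j. int (m s))"
  have k: "p - 1 < p" "p - 1 < j" "j - (p - 1) = i + 1" "j \<le> n" "i < j"
    using assms(3-5) by (auto simp: j_def)
  obtain F where F: "degree F \<le> p - 1"
    "\<And>x. x < r \<Longrightarrow> [level_count j (i + 1) x = poly F (int x)] (mod q)"
    "[coeff F (p - 1) * fact (p - 1) * P = (-1) ^ (p - 1)] (mod q)"
    using level_count_poly[OF assms(1,2) k(1,2,4)] unfolding k(3) P_def by blast
  have "int (card (adm_paths r n m i j)) = (\<Sum>x<r. level_count j (i + 1) x)"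
    by (intro card_adm_paths_above assms k)
  also have "[\<dots> = (\<Sum>x<r. poly F (int x))] (mod q)"
    by (intro cong_sum F) simp
  also have "[(\<Sum>x<r. poly F (int x)) = coeff F (p - 1) * fact (p - 1) * int (r choose Suc (p - 1))] (mod q)"
    using assms(5) by (intro sum_poly_critical_mod assms(1,2) F(1)) auto
  finally have "[int (card (adm_paths r n m i j)) * P =
      coeff F (p - 1) * fact (p - 1) * int (r choose Suc (p - 1)) * P] (mod q)"
    by (intro cong_mult cong_refl)
  also have "coeff F (p - 1) * fact (p - 1) * int (r choose Suc (p - 1)) * P =
      (coeff F (p - 1) * fact (p - 1) * P) * int (r choose p)"
    using assms(5) by simp
  also have "[\<dots> = (-1) ^ (p - 1) * int (r choose p)] (mod q)"
    by (intro cong_mult cong_refl F)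
  finally show ?thesis
    by (simp add: j_def P_def)
qed

end

section \<open>Prime divisibility of binomial coefficients\<close>

lemma not_dvd_binomial_pred:
  fixes p r :: nat
  assumes "prime p" "p dvd r" "0 < r" "k < p"
  shows "\<not> p dvd ((r - 1) choose k)"
  using assms(4)
proof (induction k)
  case 0
  then show ?case
    using assms(1) by auto
next
  case (Suc k)
  obtain r' where r': "r = Suc r'"
    using assms(3) by (cases r) auto
  have "p dvd Suc k * (r choose Suc k)"
    unfolding binomial_absorption using assms(2) by simp
  moreover have "\<not> p dvd Suc k"
    using Suc.prems by (auto dest: dvd_imp_le)
  ultimately have "p dvd (r choose Suc k)"
    using assms(1) by (simp add: prime_dvd_mult_iff del: mult_Suc)
  \<comment> \<open>By Pascal's rule \<open>r choose Suc k\<close> is the sum of the entries at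
    \<open>k\<close> and \<open>Suc k\<close> in row \<open>r - 1\<close>, so divisibility of the
    latter would pass to the former.\<close>
  then show ?case
    using Suc by (auto simp: r' dvd_add_left_iff)
qed

text \<open>From \<open>p * (r choose p) = r * ((r - 1) choose (p - 1))\<close> it follows that
  \<open>p\<close> divides \<open>r choose p\<close> exactly \<open>a - 1\<close> times, which
  leaves one factor \<open>p\<close> for \<open>\<Delta>\<close>.\<close>

lemma dvd_of_prime_power_dvd_binomial:
  fixes p a c r :: nat and \<Delta> :: int
  assumes "prime p" "0 < a" "r = p ^ a * c" "\<not> p dvd c"
    and "int (p ^ a) dvd int (r choose p) * \<Delta>"
  shows "int p dvd \<Delta>"
proof -
  have p: "0 < p"
    using assms(1) by (rule prime_gt_0_nat)
  have r: "0 < r" "p dvd r"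
    using p assms by (auto intro: dvd_mult2 dvd_power intro!: Nat.gr0I)
  have "int p * int (p ^ a) dvd int p * (int (r choose p) * \<Delta>)"
    by (intro mult_dvd_mono dvd_refl assms(5))
  also have "int p * (int (r choose p) * \<Delta>) = int (p * (r choose p)) * \<Delta>"
    by simp
  also have "p * (r choose p) = r * ((r - 1) choose (p - 1))"
    using binomial_absorption[of "p - 1" r] p by simp
  also have "int \<dots> * \<Delta> = (int c * int ((r - 1) choose (p - 1)) * \<Delta>) * int (p ^ a)"
    by (subst (1) assms(3)) simp
  finally have "int p dvd int c * int ((r - 1) choose (p - 1)) * \<Delta>"
    using p by (simp add: dvd_mult_cancel_right)
  moreover have "prime (int p)"
    using assms(1) by simp
  ultimately show ?thesis
    using assms(4) not_dvd_binomial_pred[OF assms(1) r(2,1), of "p - 1"] p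
    by (simp add: prime_dvd_mult_iff)
qed

section \<open>The invariant and its values\<close>

text \<open>In entry \<open>(i, i + d)\<close> of \<open>X * C\<close>, the terms with
  \<open>k < i\<close> vanish because \<open>X\<close> is triangular and those with
  \<open>k > i\<close> because \<open>C\<close> vanishes left of its \<open>d\<close>-th
  superdiagonal. The same happens around \<open>k = i + d\<close> in \<open>D * Y\<close>.\<close>

lemma ut_equiv_leading_diagonal_cong:
  fixes q :: int
  assumes "ut_equiv n C D" "C \<in> carrier_mat n n" "D \<in> carrier_mat n n"
    and C: "\<And>i j. i < n \<Longrightarrow> j < n \<Longrightarrow> j < i + d \<Longrightarrow> [C $$ (i, j) = 0] (mod q)"
    and D: "\<And>i j. i < n \<Longrightarrow> j < n \<Longrightarrow> j < i + d \<Longrightarrow> [D $$ (i, j) = 0] (mod q)"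
    and "i + d < n"
  shows "[C $$ (i, i + d) = D $$ (i, i + d)] (mod q)"
proof -
  obtain X Y where X: "unitriangular n X" and Y: "unitriangular n Y" and XY: "X * C = D * Y"
    using assms(1) by (auto simp: ut_equiv_def)
  let ?j = "i + d"
  have lower: "Z $$ (a, b) = 0" if "unitriangular n Z" "b < a" "a < n" for Z a b
    using that by (auto simp: unitriangular_def)
  have diag: "Z $$ (a, a) = 1" if "unitriangular n Z" "a < n" for Z a
    using that by (auto simp: unitriangular_def)
  have carr: "X \<in> carrier_mat n n" "Y \<in> carrier_mat n n"
    using X Y by (auto simp: unitriangular_def)
  have "(X * C) $$ (i, ?j) = (\<Sum>k=0..<n. X $$ (i, k) * C $$ (k, ?j))"
    using carr assms(2,6) by (auto simp: scalar_prod_def intro!: sum.cong)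
  also have "[\<dots> = (\<Sum>k=0..<n. if k = i then C $$ (i, ?j) else 0)] (mod q)"
  proof (rule cong_sum)
    fix k assume k: "k \<in> {0..<n}"
    consider "k < i" | "k = i" | "i < k" by linarith
    then show "[X $$ (i, k) * C $$ (k, ?j) = (if k = i then C $$ (i, ?j) else 0)] (mod q)"
    proof cases
      case 3
      then have "[X $$ (i, k) * C $$ (k, ?j) = X $$ (i, k) * 0] (mod q)"
        using k assms(6) by (intro cong_mult cong_refl C) auto
      with 3 show ?thesis by simp
    qed (use assms(6) lower[OF X] diag[OF X] in auto)
  qed
  also have "(\<Sum>k=0..<n. if k = i then C $$ (i, ?j) else 0) = C $$ (i, ?j)"
    using assms(6) by simp
  finally have 1: "[(X * C) $$ (i, ?j) = C $$ (i, ?j)] (mod q)" .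
  have "(D * Y) $$ (i, ?j) = (\<Sum>k=0..<n. D $$ (i, k) * Y $$ (k, ?j))"
    using carr assms(3,6) by (auto simp: scalar_prod_def intro!: sum.cong)
  also have "[\<dots> = (\<Sum>k=0..<n. if k = ?j then D $$ (i, ?j) else 0)] (mod q)"
  proof (rule cong_sum)
    fix k assume k: "k \<in> {0..<n}"
    consider "k < ?j" | "k = ?j" | "?j < k" by linarith
    then show "[D $$ (i, k) * Y $$ (k, ?j) = (if k = ?j then D $$ (i, ?j) else 0)] (mod q)"
    proof cases
      case 1
      then have "[D $$ (i, k) * Y $$ (k, ?j) = 0 * Y $$ (k, ?j)] (mod q)"
        using k assms(6) by (intro cong_mult cong_refl D) auto
      with 1 show ?thesis by simp
    qed (use k assms(6) lower[OF Y] diag[OF Y] in auto)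
  qed
  also have "(\<Sum>k=0..<n. if k = ?j then D $$ (i, ?j) else 0) = D $$ (i, ?j)"
    using assms(6) by simp
  finally show ?thesis
    using 1 XY by (metis cong_sym cong_trans)
qed

context lens_graph begin

lemma B_mat_minus_one_index:
  assumes "i < n" "j < n"
  shows "(B_mat r n m - 1\<^sub>m n) $$ (i, j) = int (card (adm_paths r n m (i + 1) (j + 1))) - (if i = j then 1 else 0)"
  using assms by (simp add: B_mat_def)

text \<open>Each row has exactly one admissible path from its 0-vertex back to itself, so
  subtracting the identity clears the diagonal.\<close>

lemma B_mat_minus_one_subcritical:
  fixes q :: int
  assumes "\<And>i. 1 \<le> i \<Longrightarrow> i < p \<Longrightarrow> coprime (int i) q" and "q dvd int r"
    and "i < n" "j < n" "j < i + p"
  shows "[(B_mat r n m - 1\<^sub>m n) $$ (i, j) = 0] (mod q)"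
proof -
  consider "i = j" | "j < i" | "i < j" by linarith
  then show ?thesis
  proof cases
    case 1
    then show ?thesis
      using assms(3) card_adm_paths_same[of "i + 1"]
      unfolding B_mat_minus_one_index[OF assms(3,4)] by simp
  next
    case 2
    then show ?thesis
      using assms(3) card_adm_paths_below[of "i + 1" "j + 1"]
      unfolding B_mat_minus_one_index[OF assms(3,4)] by simp
  next
    case 3
    then have "[int (card (adm_paths r n m (i + 1) (j + 1))) = 0] (mod q)"
      using assms(3-5) by (intro card_adm_paths_subcritical[of p] assms(1,2)) auto
    with 3 show ?thesis
      unfolding B_mat_minus_one_index[OF assms(3,4)] by simp
  qed
qed

end

text \<open>The invariant of the class. Matrix row \<open>e\<close> is graph row
  \<open>e + 1\<close>, so entry \<open>(e, e + p)\<close> sees the \<open>p - 1\<close> units with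
  indices \<open>e + 2\<close> to \<open>e + p\<close>.\<close>

lemma sim_imp_window_prod_cong:
  assumes "lens_graph r n m" "lens_graph r n m'"
    and "prime p" "odd p" "0 < a" "r = p ^ a * c" "\<not> p dvd c"
    and "sim n (B_mat r n m) (B_mat r n m')" "e + p < n"
  shows "[(\<Prod>s=e+2..<e+1+p. m s) = (\<Prod>s=e+2..<e+1+p. m' s)] (mod p)"
proof -
  interpret A: lens_graph r n m by fact
  interpret B: lens_graph r n m' by fact
  define q where "q = int (p ^ a)"
  have p: "0 < p"
    using assms(3) by (rule prime_gt_0_nat)
  have cop: "coprime (int i) q" if "1 \<le> i" "i < p" for i
  proof -
    have "\<not> p dvd i"
      using that by (auto dest: dvd_imp_le)
    then have "coprime i p"
      using assms(3) by (metis prime_imp_coprime coprime_commute)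
    then show ?thesis
      by (simp add: q_def)
  qed
  have q: "q dvd int r"
    by (simp add: q_def assms(6))
  define b b' P P' C where "b = (B_mat r n m - 1\<^sub>m n) $$ (e, e + p)"
    and "b' = (B_mat r n m' - 1\<^sub>m n) $$ (e, e + p)"
    and "P = int (\<Prod>s=e+2..<e+1+p. m s)" and "P' = int (\<Prod>s=e+2..<e+1+p. m' s)"
    and "C = int (r choose p)"
  have b: "b = int (card (adm_paths r n m (e + 1) (e + 1 + p)))"
    unfolding b_def by (subst A.B_mat_minus_one_index) (use assms(9) p in auto)
  have b': "b' = int (card (adm_paths r n m' (e + 1) (e + 1 + p)))"
    unfolding b'_def by (subst B.B_mat_minus_one_index) (use assms(9) p in auto)
  have sign: "(-1 :: int) ^ (p - 1) = 1"
    using assms(4) p by simp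
  have crit: "[b * P = C] (mod q)" "[b' * P' = C] (mod q)"
    using A.card_adm_paths_critical[OF cop q, where p = p and i = "e + 1"]
      B.card_adm_paths_critical[OF cop q, where p = p and i = "e + 1"] assms(9) p
    unfolding b b' P_def P'_def C_def sign by (simp_all del: prod.op_ivl_Suc)
  have b_cong: "[b = b'] (mod q)"
    unfolding b_def b'_def
  proof (rule ut_equiv_leading_diagonal_cong[where n = n])
    show "ut_equiv n (B_mat r n m - 1\<^sub>m n) (B_mat r n m' - 1\<^sub>m n)"
      using assms(8) by (simp only: sim_def)
    show "B_mat r n m - 1\<^sub>m n \<in> carrier_mat n n" "B_mat r n m' - 1\<^sub>m n \<in> carrier_mat n n"
      by auto
    fix i j assume "i < n" "j < n" "j < i + p"
    then show "[(B_mat r n m - 1\<^sub>m n) $$ (i, j) = 0] (mod q)"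
        "[(B_mat r n m' - 1\<^sub>m n) $$ (i, j) = 0] (mod q)"
      using A.B_mat_minus_one_subcritical[OF cop q] B.B_mat_minus_one_subcritical[OF cop q]
      by blast+
  qed fact
  \<comment> \<open>Cross-multiplying the two critical congruences compares \<open>P\<close> and
    \<open>P'\<close> without inverting either.\<close>
  have "[C * P' = b * P * P'] (mod q)"
    using crit(1) by (intro cong_mult cong_refl) (rule cong_sym)
  also have "[b * P * P' = b' * P * P'] (mod q)"
    by (intro cong_mult cong_refl b_cong)
  also have "b' * P * P' = b' * P' * P"
    by simp
  also have "[b' * P' * P = C * P] (mod q)"
    by (intro cong_mult cong_refl crit(2))
  finally have "[C * P' = C * P] (mod q)" .
  then have "q dvd C * (P' - P)"
    by (simp add: cong_iff_dvd_diff right_diff_distrib)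
  then have "int p dvd P' - P"
    unfolding q_def C_def by (rule dvd_of_prime_power_dvd_binomial[OF assms(3,5,6,7)])
  then have "[P' = P] (mod int p)"
    by (simp add: cong_iff_dvd_diff)
  then show ?thesis
    unfolding P_def P'_def cong_int_iff by (rule cong_sym)
qed

section \<open>Prescribing the window products\<close>

lemma exists_window_prod:
  fixes p :: nat and \<tau> :: "nat \<Rightarrow> nat"
  assumes "2 \<le> p" and "\<And>e. e < N \<Longrightarrow> coprime (\<tau> e) p"
  shows "\<exists>\<mu>. (\<forall>s. coprime (\<mu> s) p) \<and> (\<forall>e<N. [(\<Prod>s=e+2..<e+1+p. \<mu> s) = \<tau> e] (mod p))"
  using assms(2)
proof (induction N)
  case 0
  then show ?case
    by (intro exI[of _ "\<lambda>_. 1"]) simp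
next
  case (Suc N)
  then obtain \<mu> where \<mu>: "\<And>s. coprime (\<mu> s) p"
    "\<And>e. e < N \<Longrightarrow> [(\<Prod>s=e+2..<e+1+p. \<mu> s) = \<tau> e] (mod p)"
    by (metis less_Suc_eq)
  define Q where "Q = (\<Prod>s=N+2..<N+p. \<mu> s)"
  have "coprime Q p"
    unfolding Q_def by (intro prod_coprime_left \<mu>)
  then obtain y where y: "[Q * y = 1] (mod p)"
    using cong_solve_coprime_nat[of Q p] by auto
  then have "coprime y p"
    using coprime_iff_invertible_nat[of y p] by (auto simp: mult.commute)
  \<comment> \<open>Index \<open>N + p\<close> is the last one in window \<open>N\<close> and lies
    in no earlier window, so its value is free; \<open>y\<close> cancels the product
    \<open>Q\<close> of the other factors.\<close>
  define \<nu> where "\<nu> = \<mu>(N + p := y * \<tau> N)"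
  have "coprime (\<nu> s) p" for s
    using \<open>coprime y p\<close> \<mu>(1) Suc.prems[of N] by (simp add: \<nu>_def)
  moreover have "[(\<Prod>s=e+2..<e+1+p. \<nu> s) = \<tau> e] (mod p)" if "e < Suc N" for e
  proof (cases "e = N")
    case True
    have "(\<Prod>s=N+2..<N+p. \<nu> s) = Q"
      unfolding Q_def by (intro prod.cong) (auto simp: \<nu>_def)
    then have "(\<Prod>s=N+2..<N+1+p. \<nu> s) = (Q * y) * \<tau> N"
      using assms(1) by (simp add: \<nu>_def)
    also have "[\<dots> = 1 * \<tau> N] (mod p)"
      by (intro cong_mult cong_refl y)
    finally show ?thesis
      by (simp add: True)
  next
    case False
    with that have "e < N" by simp
    moreover from this have "(\<Prod>s=e+2..<e+1+p. \<nu> s) = (\<Prod>s=e+2..<e+1+p. \<mu> s)"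
      by (intro prod.cong) (auto simp: \<nu>_def)
    ultimately show ?thesis
      using \<mu>(2) by simp
  qed
  ultimately show ?case by blast
qed

lemma exists_totative_residues:
  fixes p \<alpha> x :: "'a \<Rightarrow> nat" and r j :: nat
  assumes "finite I" and "r > 1" and r: "r = 2 ^ j * (\<Prod>i\<in>I. p i ^ \<alpha> i)"
    and p: "\<And>i. i \<in> I \<Longrightarrow> prime (p i) \<and> odd (p i)" and "inj_on p I"
    and "\<And>i. i \<in> I \<Longrightarrow> 1 \<le> \<alpha> i" and x: "\<And>i. i \<in> I \<Longrightarrow> coprime (x i) (p i)"
  shows "\<exists>y\<in>totatives r. \<forall>i\<in>I. [y = x i] (mod p i)"
proof -
  \<comment> \<open>The prime 2 is included with prescribed residue 1, so that the solution is odd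
    and hence coprime to the factor \<open>2 ^ j\<close> as well.\<close>
  define P where "P = insert 2 (p ` I)"
  have prime_P: "prime l" if "l \<in> P" for l
    using that p by (auto simp: P_def)
  define u where "u l = (if l = 2 then 1 else x (the_inv_into I p l))" for l
  have "finite P"
    using assms(1) by (simp add: P_def)
  moreover have "\<forall>l\<in>P. \<forall>l'\<in>P. l \<noteq> l' \<longrightarrow> coprime l l'"
    using prime_P by (blast intro: primes_coprime)
  ultimately obtain z where z: "\<And>l. l \<in> P \<Longrightarrow> [z = u l] (mod l)"
    using chinese_remainder_nat[of P "\<lambda>l. l" u] by blast
  have zp: "[z = x i] (mod p i)" if "i \<in> I" for i
  proof -
    have "p i \<noteq> 2"
      using p[OF that] by auto
    then have "u (p i) = x i"
      using that assms(5) by (simp add: u_def the_inv_into_f_f)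
    with that show ?thesis
      using z[of "p i"] by (simp add: P_def)
  qed
  have "coprime z 2"
    using z[of 2] by (auto simp: P_def u_def cong_def odd_iff_mod_2_eq_one)
  moreover have "coprime z (p i)" if "i \<in> I" for i
    using x[OF that] cong_imp_coprime[OF cong_sym[OF zp[OF that]]] by simp
  ultimately have "coprime z r"
    unfolding r by (auto intro!: prod_coprime_right)
  then have "coprime (z mod r) r"
    using assms(2) by simp
  moreover have "z mod r \<noteq> 0"
  proof
    assume "z mod r = 0"
    with \<open>coprime (z mod r) r\<close> have "coprime 0 r"
      by metis
    then show False
      using assms(2) by simp
  qed
  ultimately have "z mod r \<in> totatives r"
    using assms(2) by (simp add: in_totatives_iff)
  moreover have "[z mod r = x i] (mod p i)" if "i \<in> I" for i
  proof -
    have "p i dvd p i ^ \<alpha> i"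
      using assms(6)[OF that] by simp
    also have "\<dots> dvd (\<Prod>i\<in>I. p i ^ \<alpha> i)"
      using assms(1) that by (rule dvd_prodI)
    finally have "p i dvd r"
      unfolding r by (rule dvd_mult)
    then have "[z mod r = z] (mod p i)"
      by (simp add: cong_def mod_mod_cancel)
    then show ?thesis
      using zp[OF that] by (rule cong_trans)
  qed
  ultimately show ?thesis by blast
qed

section \<open>Counting classes\<close>

lemma sim_refl:
  assumes "A \<in> carrier_mat n n"
  shows "sim n A A"
proof -
  have "unitriangular n (1\<^sub>m n)"
    by (auto simp: unitriangular_def)
  with assms show ?thesis
    unfolding sim_def ut_equiv_def by (intro exI[of _ "1\<^sub>m n"]) simp
qed

text \<open>Reflexivity places \<open>f y\<close> in its own class, so equal classes of
  \<open>f x\<close> and \<open>f y\<close> give \<open>sim n (f x) (f y)\<close>; hence distinct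
  elements of \<open>T\<close> yield distinct classes.\<close>

lemma card_le_num_classes:
  assumes "f ` T \<subseteq> S_set r n"
    and "\<And>x y. x \<in> T \<Longrightarrow> y \<in> T \<Longrightarrow> sim n (f x) (f y) \<Longrightarrow> x = y"
  shows "card T \<le> num_classes r n"
proof -
  let ?S = "S_set r n"
  let ?R = "{(A, B). A \<in> ?S \<and> B \<in> ?S \<and> sim n A B}"
  have refl: "sim n A A" if "A \<in> ?S" for A
    using that by (intro sim_refl) (auto simp: S_set_def B_mat_def)
  have "finite ?S"
    unfolding S_set_def by (intro finite_imageI finite_PiE) simp_all
  then have fin: "finite (?S // ?R)"
    by (simp add: quotient_def)
  have inj: "inj_on (\<lambda>x. ?R `` {f x}) T"
  proof (rule inj_onI)
    fix x y assume xy: "x \<in> T" "y \<in> T" and eq: "?R `` {f x} = ?R `` {f y}"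
    have "f y \<in> ?R `` {f y}"
      using xy(2) assms(1) refl by auto
    then have "sim n (f x) (f y)"
      unfolding eq[symmetric] by simp
    with xy show "x = y"
      by (rule assms(2))
  qed
  have "(\<lambda>x. ?R `` {f x}) ` T \<subseteq> ?S // ?R"
    using assms(1) by (auto simp: quotient_def)
  then show ?thesis
    unfolding num_classes_def by (rule card_inj_on_le[OF inj _ fin])
qed

text \<open>For \<open>n < p\<close> the real power lies in the interval from 0 (exclusive) to 1, so
  its ceiling is 1. This matches the truncated exponent \<open>n - p = 0\<close>.\<close>

lemma ceiling_powi_diff:
  fixes p n :: nat
  assumes "2 \<le> p"
  shows "\<lceil>(real p - 1) powi (int n - int p)\<rceil> = int ((p - 1) ^ (n - p))"
proof (cases "p \<le> n")
  case True
  then have "(real p - 1) powi (int n - int p) = real ((p - 1) ^ (n - p))"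
    using assms by (simp add: of_nat_diff flip: power_int_of_nat)
  then show ?thesis
    by (simp only: ceiling_of_nat)
next
  case False
  define d where "d = p - n"
  have d: "int n - int p = - int d"
    using False by (simp add: d_def)
  have "1 \<le> (real p - 1) ^ d"
    using assms by (intro one_le_power) simp
  then have "0 < inverse ((real p - 1) ^ d)" "inverse ((real p - 1) ^ d) \<le> 1"
    using le_imp_inverse_le[of 1 "(real p - 1) ^ d"] by simp_all
  then have "\<lceil>inverse ((real p - 1) ^ d)\<rceil> = 1"
    by (simp add: ceiling_eq_iff)
  then show ?thesis
    using False by (simp add: d power_int_minus)
qed

theorem theorem3p9:
  fixes r j k n :: nat and p \<alpha> :: "nat \<Rightarrow> nat"
  assumes "r > 2"
    and "r = 2 ^ j * (\<Prod>i=1..k. p i ^ \<alpha> i)"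
    and "\<And>i. i \<in> {1..k} \<Longrightarrow> prime (p i) \<and> odd (p i)"
    and "inj_on p {1..k}"
    and "\<And>i. i \<in> {1..k} \<Longrightarrow> \<alpha> i \<ge> 1"
    and "n \<ge> 1"
  shows "int (num_classes r n) \<ge> (\<Prod>i=1..k. \<lceil>(real (p i) - 1) powi (int n - int (p i))\<rceil>)"
proof -
  let ?I = "{1..k}"
  \<comment> \<open>A member of \<open>T\<close> prescribes a nonzero residue modulo each
    \<open>p i\<close> for each of the \<open>n - p i\<close> windows; the size of \<open>T\<close>
    is the desired bound.\<close>
  define T where "T = (\<Pi>\<^sub>E i\<in>?I. \<Pi>\<^sub>E e\<in>{..<n - p i}. {1..<p i})"
  have p2: "2 \<le> p i" if "i \<in> ?I" for i
    using assms(3)[OF that] prime_ge_2_nat by blast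
  have "\<exists>m. m \<in> {1..n} \<rightarrow>\<^sub>E totatives r \<and>
      (\<forall>i\<in>?I. \<forall>e<n - p i. [(\<Prod>s=e+2..<e+1+p i. m s) = \<tau> i e] (mod p i))" if \<tau>: "\<tau> \<in> T" for \<tau>
  proof -
    have "\<exists>\<mu>. (\<forall>s. coprime (\<mu> s) (p i)) \<and>
        (\<forall>e<n - p i. [(\<Prod>s=e+2..<e+1+p i. \<mu> s) = \<tau> i e] (mod p i))" if i: "i \<in> ?I" for i
    proof (rule exists_window_prod[OF p2[OF i]])
      fix e assume "e < n - p i"
      then have "\<tau> i e \<in> {1..<p i}"
        using \<tau> i by (auto simp: T_def PiE_iff)
      then have "\<not> p i dvd \<tau> i e"
        by (auto dest: dvd_imp_le)
      then show "coprime (\<tau> i e) (p i)"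
        using assms(3)[OF i] prime_imp_coprime[of "p i" "\<tau> i e"] by (simp add: coprime_commute)
    qed
    then obtain \<mu> where \<mu>: "\<And>i s. i \<in> ?I \<Longrightarrow> coprime (\<mu> i s) (p i)"
      "\<And>i e. i \<in> ?I \<Longrightarrow> e < n - p i \<Longrightarrow> [(\<Prod>s=e+2..<e+1+p i. \<mu> i s) = \<tau> i e] (mod p i)"
      by metis
    \<comment> \<open>The solutions for the separate primes are glued position by position.\<close>
    have "\<exists>y\<in>totatives r. \<forall>i\<in>?I. [y = \<mu> i s] (mod p i)" for s
      using assms(1,3,4,5) \<mu>(1) by (intro exists_totative_residues[OF _ _ assms(2)]) auto
    then obtain m where m: "\<And>s. m s \<in> totatives r" "\<And>s i. i \<in> ?I \<Longrightarrow> [m s = \<mu> i s] (mod p i)"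
      by metis
    \<comment> \<open>For \<open>e < n - p i\<close> the window lies inside \<open>{1..n}\<close>,
      so the restriction leaves its product unchanged.\<close>
    have "[(\<Prod>s=e+2..<e+1+p i. restrict m {1..n} s) = \<tau> i e] (mod p i)"
      if "i \<in> ?I" "e < n - p i" for i e
    proof -
      have "[(\<Prod>s=e+2..<e+1+p i. restrict m {1..n} s) = (\<Prod>s=e+2..<e+1+p i. \<mu> i s)] (mod p i)"
        using that m(2) by (intro cong_prod) auto
      then show ?thesis
        using \<mu>(2)[OF that] by (rule cong_trans)
    qed
    then show ?thesis
      using m(1) by (intro exI[of _ "restrict m {1..n}"]) auto
  qed
  then obtain M where M: "\<And>\<tau>. \<tau> \<in> T \<Longrightarrow> M \<tau> \<in> {1..n} \<rightarrow>\<^sub>E totatives r"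
    "\<And>\<tau> i e. \<tau> \<in> T \<Longrightarrow> i \<in> ?I \<Longrightarrow> e < n - p i \<Longrightarrow>
      [(\<Prod>s=e+2..<e+1+p i. M \<tau> s) = \<tau> i e] (mod p i)"
    by metis
  have lens: "lens_graph r n (M \<tau>)" if "\<tau> \<in> T" for \<tau>
    using M(1)[OF that] assms(1) by unfold_locales (auto simp: PiE_iff in_totatives_iff)
  have "card T \<le> num_classes r n"
  proof (rule card_le_num_classes)
    show "(\<lambda>\<tau>. B_mat r n (M \<tau>)) ` T \<subseteq> S_set r n"
      using M(1) by (auto simp: S_set_def)
    fix \<tau> \<tau>' assume \<tau>: "\<tau> \<in> T" "\<tau>' \<in> T" and sim: "sim n (B_mat r n (M \<tau>)) (B_mat r n (M \<tau>'))"
    have "\<tau> i e = \<tau>' i e" if i: "i \<in> ?I" and e: "e < n - p i" for i e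
    proof -
      \<comment> \<open>The cofactor of the full power of \<open>p i\<close> in
        \<open>r\<close>.\<close>
      define c where "c = 2 ^ j * (\<Prod>l\<in>?I - {i}. p l ^ \<alpha> l)"
      have r: "r = p i ^ \<alpha> i * c"
        unfolding c_def assms(2) using i by (subst prod.remove[of _ i]) auto
      have "coprime (p i) (2 ^ j)"
        using assms(3)[OF i] by simp
      moreover have "coprime (p i) (p l ^ \<alpha> l)" if "l \<in> ?I - {i}" for l
        using that i assms(3)[of i] assms(3)[of l] inj_onD[OF assms(4), of i l]
        by (auto intro!: primes_coprime)
      then have "coprime (p i) (\<Prod>l\<in>?I - {i}. p l ^ \<alpha> l)"
        by (rule prod_coprime_right)
      ultimately have "coprime (p i) c"
        unfolding c_def by simp
      then have "\<not> p i dvd c"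
        using p2[OF i] coprime_absorb_left[of "p i" c] by auto
      then have "[(\<Prod>s=e+2..<e+1+p i. M \<tau> s) = (\<Prod>s=e+2..<e+1+p i. M \<tau>' s)] (mod p i)"
        using assms(3)[OF i] assms(5)[OF i] e
        by (intro sim_imp_window_prod_cong[OF lens[OF \<tau>(1)] lens[OF \<tau>(2)] _ _ _ r _ sim]) auto
      then have "[\<tau> i e = \<tau>' i e] (mod p i)"
        using M(2)[OF \<tau>(1) i e] M(2)[OF \<tau>(2) i e] by (metis cong_sym cong_trans)
      \<comment> \<open>Both values are reduced residues, so their congruence is an
        equality.\<close>
      moreover have "\<tau> i e < p i" "\<tau>' i e < p i"
        using \<tau> i e by (auto simp: T_def PiE_iff)
      ultimately show ?thesis
        by (simp add: cong_def)
    qed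
    then have "\<tau> i = \<tau>' i" if "i \<in> ?I" for i
      using \<tau> that by (intro PiE_ext[of "\<tau> i" "{..<n - p i}" "\<lambda>_. {1..<p i}"]) (auto simp: T_def PiE_iff)
    then show "\<tau> = \<tau>'"
      by (rule PiE_ext[OF \<tau>[unfolded T_def]])
  qed
  moreover have "card T = (\<Prod>i=1..k. (p i - 1) ^ (n - p i))"
    by (simp add: T_def card_PiE)
  moreover have "(\<Prod>i=1..k. \<lceil>(real (p i) - 1) powi (int n - int (p i))\<rceil>) =
      int (\<Prod>i=1..k. (p i - 1) ^ (n - p i))"
    unfolding of_nat_prod by (intro prod.cong refl ceiling_powi_diff p2)
  ultimately show ?thesis
    by (simp only: of_nat_le_iff)
qed

end
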